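(* Let $n$ and $k$ be integers with $n\geq 1$ and $1\leq k\leq n$, and let $G_{n,k}$ be the bipartite graph obtained by deleting a matching of size $k$ from the complete bipartite graph $K_{n,n}$. If $(n,k)\notin\{(1,1),\,(2,1),\,(3,2),\,(3,3)\}$, then $q(G_{n,k})=2$.
   Context: For a simple graph $G$ on vertices $1,\ldots,N$, let $\mathcal{S}(G)$ be the set of all $N\times N$ real symmetric matrices $A$ such that for all $i\neq j$, $A_{ij}\neq 0$ if and only if $i$ and $j$ are adjacent in $G$ (the diagonal entries of $A$ are arbitrary). The parameter $q(G)$ is the minimum number of distinct eigenvalues of a matrix in $\mathcal{S}(G)$. Deleting a matching of size $k$ means removing $k$ pairwise disjoint edges while keeping all vertices. *)

theory Defs
  imports "Jordan_Normal_Form.Spectral_Radius"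
begin

text \<open>
  A graph is given by its number N of vertices and its set of edges, which are two-element
  subsets of the vertex set \<open>{..<N}\<close>: vertices are numbered from 0, in agreement with the
  indexing of matrices.
\<close>

definition simple_graph :: "nat \<Rightarrow> nat set set \<Rightarrow> bool" where
  "simple_graph N E \<longleftrightarrow> (\<forall>e\<in>E. e \<subseteq> {..<N} \<and> card e = 2)"

definition sym_mats :: "nat \<Rightarrow> nat set set \<Rightarrow> real mat set" where
  "sym_mats N E = {A \<in> carrier_mat N N. transpose_mat A = A \<and>
     (\<forall>i<N. \<forall>j<N. i \<noteq> j \<longrightarrow> (A $$ (i, j) \<noteq> 0 \<longleftrightarrow> {i, j} \<in> E))}"

text \<open>
  The spectrum is taken over the reals; as the matrices are real and symmetric, it contains all
  of their complex eigenvalues.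
\<close>

definition q :: "nat \<Rightarrow> nat set set \<Rightarrow> nat" where
  "q N E = (LEAST d. \<exists>A\<in>sym_mats N E. d = card (spectrum A))"

lemma q_attained: "\<exists>A\<in>sym_mats N E. q N E = card (spectrum A)"
proof -
  define A :: "real mat" where "A = mat N N (\<lambda>(i, j). if {i, j} \<in> E then 1 else 0)"
  have "A \<in> sym_mats N E"
    unfolding sym_mats_def A_def by (auto simp: insert_commute[of _ _ "{}"])
  then have "\<exists>d. \<exists>A\<in>sym_mats N E. d = card (spectrum A)"
    by blast
  from LeastI_ex[OF this] show ?thesis
    unfolding q_def .
qed

text \<open>The parts are \<open>{..<m}\<close> and \<open>{m..<m + n}\<close>; the number of vertices is \<open>m + n\<close>.\<close>

definition complete_bipartite :: "nat \<Rightarrow> nat \<Rightarrow> nat set set" where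
  "complete_bipartite m n = {{i, j} | i j. i \<in> {..<m} \<and> j \<in> {m..<m + n}}"

definition matching :: "nat set set \<Rightarrow> nat set set \<Rightarrow> bool" where
  "matching E M \<longleftrightarrow> M \<subseteq> E \<and> pairwise disjnt M"

lemma simple_graph_complete_bipartite_delete:
  "simple_graph (m + n) (complete_bipartite m n - M)"
  by (auto simp: simple_graph_def complete_bipartite_def card_insert_if)

end

theory Submission
  imports Defs
begin

text \<open>
  For an orthogonal matrix \<open>Q\<close> with zero pattern given by \<open>M\<close>, the symmetric matrix
  \<open>[[0, Q], [Q\<^sup>T, 0]]\<close> squares to the identity, so its eigenvalues are \<open>1\<close> and \<open>-1\<close>; conversely
  a real symmetric matrix with a single eigenvalue is scalar. It remains to find orthogonal
  matrices of order \<open>n\<close> with exactly \<open>k\<close> zeros, all on the diagonal. If \<open>[[N, u], [v\<^sup>T, 0]]\<close> and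
  \<open>[[N', u'], [v'\<^sup>T, 0]]\<close> are orthogonal, so is \<open>[[N, u v'\<^sup>T], [u' v\<^sup>T, N']]\<close>. Gluing a matrix with
  parameters \<open>(n, k)\<close> to one with \<open>(4, 4)\<close> or \<open>(3, 1)\<close> thus gives \<open>(n + 2, k + 2)\<close> or
  \<open>(n + 1, k - 1)\<close>, which reduces everything to a few explicit small matrices.
\<close>

subsection \<open>Orthogonal matrices with prescribed diagonal zeros\<close>

text \<open>Indices range over an arbitrary set so that matrices can be glued along unions of index
  sets. Only the rows are required to be orthonormal; for finite \<open>I\<close> this carries over
  to the columns.\<close>

definition orth_pattern :: "'a set \<Rightarrow> 'a set \<Rightarrow> ('a \<Rightarrow> 'a \<Rightarrow> real) \<Rightarrow> bool" where
  "orth_pattern I Z A \<longleftrightarrow>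
     (\<forall>i\<in>I. \<forall>j\<in>I. (\<Sum>t\<in>I. A i t * A j t) = (if i = j then 1 else 0) \<and>
        (A i j = 0 \<longleftrightarrow> i = j \<and> i \<in> Z))"

text \<open>A simultaneous permutation of rows and columns moves the diagonal zeros anywhere, so all
  choices of \<open>I\<close> and \<open>Z\<close> are demanded at once.\<close>

definition pattern_exists :: "nat \<Rightarrow> nat \<Rightarrow> bool" where
  "pattern_exists n k \<longleftrightarrow>
     (\<forall>I Z :: nat set. finite I \<longrightarrow> card I = n \<longrightarrow> Z \<subseteq> I \<longrightarrow> card Z = k \<longrightarrow> (\<exists>A. orth_pattern I Z A))"

text \<open>The complements of \<open>Z\<close> and \<open>Y\<close> are equinumerous, so any
  bijection between them completes \<open>g\<close>. This serves both to relabel diagonal zeros and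
  to extend a matching to a permutation.\<close>

lemma ex_bij_betw_extend:
  assumes "finite I" "finite J" "card I = card J" "Z \<subseteq> I" "Y \<subseteq> J" and g: "bij_betw g Z Y"
  shows "\<exists>f. bij_betw f I J \<and> (\<forall>i\<in>Z. f i = g i) \<and> (\<forall>i\<in>I. f i \<in> Y \<longleftrightarrow> i \<in> Z)"
proof -
  have "finite Z" "finite Y" "card Z = card Y"
    using assms finite_subset bij_betw_same_card[OF g] by auto
  then obtain h where h: "bij_betw h (I - Z) (J - Y)"
    using finite_same_card_bij[of "I - Z" "J - Y"] assms by (auto simp: card_Diff_subset)
  let ?f = "\<lambda>i. if i \<in> Z then g i else h i"
  have "bij_betw ?f (Z \<union> (I - Z)) (Y \<union> (J - Y))"
    by (rule bij_betw_disjoint_Un[OF g h]) auto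
  then have "bij_betw ?f I J"
    using assms by (simp add: Un_absorb1)
  moreover have "?f i \<in> Y \<longleftrightarrow> i \<in> Z" if "i \<in> I" for i
    using g h that by (auto simp: bij_betw_def)
  ultimately show ?thesis
    by (intro exI[of _ ?f]) simp
qed

text \<open>Dividing each row by its norm makes orthogonal nonzero rows orthonormal without moving
  zeros, so witnesses need not be normalised. The case \<open>i = j\<close> of \<open>orth\<close>
  says that a row is nonzero.\<close>

lemma pattern_existsI:
  fixes B :: "nat \<Rightarrow> nat \<Rightarrow> real"
  assumes "k \<le> n"
    and orth: "\<And>i j. i < n \<Longrightarrow> j < n \<Longrightarrow> (\<Sum>t<n. B i t * B j t) = 0 \<longleftrightarrow> i \<noteq> j"
    and zero: "\<And>i j. i < n \<Longrightarrow> j < n \<Longrightarrow> B i j = 0 \<longleftrightarrow> i = j \<and> i < k"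
  shows "pattern_exists n k"
  unfolding pattern_exists_def
proof (intro allI impI)
  fix I Z :: "nat set"
  assume I: "finite I" "card I = n" "Z \<subseteq> I" "card Z = k"
  obtain g where "bij_betw g Z {..<k}"
    using finite_same_card_bij[of Z "{..<k}"] I finite_subset by auto
  then obtain f where f: "bij_betw f I {..<n}" "\<forall>i\<in>I. f i < k \<longleftrightarrow> i \<in> Z"
    using ex_bij_betw_extend[of I "{..<n}" Z "{..<k}" g] I \<open>k \<le> n\<close> by auto
  define r where "r i = sqrt (\<Sum>t<n. (B i t)\<^sup>2)" for i
  define A where "A i j = B (f i) (f j) / r (f i)" for i j
  have r: "r i > 0" "r i * r i = (\<Sum>t<n. B i t * B i t)" if "i < n" for i
  proof -
    have "(\<Sum>t<n. (B i t)\<^sup>2) \<noteq> 0"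
      using orth[OF that that] by (simp add: power2_eq_square)
    moreover have "(\<Sum>t<n. (B i t)\<^sup>2) \<ge> 0"
      by (simp add: sum_nonneg)
    ultimately show "r i > 0" by (simp add: r_def)
    show "r i * r i = (\<Sum>t<n. B i t * B i t)"
      using \<open>0 \<le> _\<close> by (simp add: r_def power2_eq_square)
  qed
  have "orth_pattern I Z A"
    unfolding orth_pattern_def
  proof (intro ballI conjI)
    fix i j assume ij: "i \<in> I" "j \<in> I"
    then have fij: "f i < n" "f j < n" and inj: "f i = f j \<longleftrightarrow> i = j"
      using f by (auto simp: bij_betw_def inj_on_def)
    show "A i j = 0 \<longleftrightarrow> i = j \<and> i \<in> Z"
      using zero[OF fij] r(1)[OF fij(1)] inj f(2) ij by (auto simp: A_def)
    have "(\<Sum>t\<in>I. A i t * A j t) = (\<Sum>t<n. B (f i) t * B (f j) t / (r (f i) * r (f j)))"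
      by (simp add: A_def sum.reindex_bij_betw[OF f(1), symmetric])
    also have "\<dots> = (\<Sum>t<n. B (f i) t * B (f j) t) / (r (f i) * r (f j))"
      by (simp add: sum_divide_distrib)
    also have "\<dots> = (if i = j then 1 else 0)"
      using orth[OF fij] inj r(1)[OF fij(1)] r(2)[OF fij(1)] by (auto)
    finally show "(\<Sum>t\<in>I. A i t * A j t) = (if i = j then 1 else 0)" .
  qed
  then show "\<exists>A. orth_pattern I Z A" by blast
qed

text \<open>Dropping the shared position \<open>z\<close> from a product of rows of \<open>A\<close>
  loses \<open>A i z * A j z\<close>; the block with entries \<open>A i z * B z j\<close> restores
  exactly this, since row \<open>z\<close> of \<open>B\<close> has norm 1 and
  \<open>B z z = 0\<close>. Symmetrically for \<open>B\<close>. Rows from different parts stay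
  orthogonal because row \<open>z\<close> is orthogonal to all others and vanishes at
  \<open>z\<close>. The new blocks have no zeros, being products of off-diagonal entries.\<close>

lemma pattern_exists_glue:
  assumes "pattern_exists (Suc a) (Suc k)" "pattern_exists (Suc b) (Suc l)"
    and "k \<le> a" "l \<le> b"
  shows "pattern_exists (a + b) (k + l)"
  unfolding pattern_exists_def
proof (intro allI impI)
  fix K Z :: "nat set"
  assume K: "finite K" "card K = a + b" "Z \<subseteq> K" "card Z = k + l"
  then have "finite Z" by (simp add: finite_subset)
  obtain Z1 where Z1: "Z1 \<subseteq> Z" "card Z1 = k"
    using obtain_subset_with_card_n[of k Z] K by auto
  have "card (K - Z) = (a - k) + (b - l)"
    using K \<open>finite Z\<close> assms(3,4) by (simp add: card_Diff_subset)
  \<comment> \<open>\<open>I\<close> consists of \<open>k\<close> zero positions and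
    \<open>a - k\<close> others; the remainder \<open>J\<close> then has \<open>b\<close> indices,
    \<open>l\<close> of them zero positions.\<close>
  then obtain F where F: "F \<subseteq> K - Z" "card F = a - k"
    using obtain_subset_with_card_n[of "a - k" "K - Z"] by auto
  define I where "I = Z1 \<union> F"
  define J where "J = K - I"
  define Z2 where "Z2 = Z - Z1"
  have fin: "finite I" "finite J" "finite Z1" "finite Z2" "finite F"
    using K Z1 F \<open>finite Z\<close> unfolding I_def J_def Z2_def by (auto intro: finite_subset)
  have disj: "I \<inter> J = {}" "I \<union> J = K" "Z1 \<subseteq> I" "Z2 \<subseteq> J"
    using K Z1 F unfolding I_def J_def Z2_def by auto
  have cI: "card I = a"
    unfolding I_def using Z1 F fin assms(3) by (subst card_Un_disjoint) auto
  have cJ: "card J = b"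
    unfolding J_def using disj fin cI K by (subst card_Diff_subset) auto
  have cZ2: "card Z2 = l"
    unfolding Z2_def using Z1 K fin by (subst card_Diff_subset) auto
  \<comment> \<open>The common position of both matrices, removed by the gluing.\<close>
  obtain z where z: "z \<notin> K"
    using ex_new_if_finite[OF infinite_UNIV_nat K(1)] by blast
  then have zI: "z \<notin> I" "z \<notin> J" "z \<notin> Z1" "z \<notin> Z2"
    using disj by auto
  obtain A where A: "orth_pattern (insert z I) (insert z Z1) A"
    using assms(1)[unfolded pattern_exists_def, rule_format, of "insert z I" "insert z Z1"]
      fin zI disj cI Z1 by auto
  obtain B where B: "orth_pattern (insert z J) (insert z Z2) B"
    using assms(2)[unfolded pattern_exists_def, rule_format, of "insert z J" "insert z Z2"]
      fin zI disj cJ cZ2 by auto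
  define C where "C i j = (if i \<in> I then if j \<in> I then A i j else A i z * B z j
      else if j \<in> I then B i z * A z j else B i j)" for i j
  \<comment> \<open>Row products without the term at \<open>z\<close>, also for row \<open>z\<close>
    itself.\<close>
  have Aorth: "(\<Sum>t\<in>I. A i t * A j t) = (if i = j then 1 else 0) - A i z * A j z"
    if "i \<in> insert z I" "j \<in> insert z I" for i j
    using A that fin zI by (auto simp: orth_pattern_def algebra_simps)
  have Borth: "(\<Sum>t\<in>J. B i t * B j t) = (if i = j then 1 else 0) - B i z * B j z"
    if "i \<in> insert z J" "j \<in> insert z J" for i j
    using B that fin zI by (auto simp: orth_pattern_def algebra_simps)
  have zz: "A z z = 0" "B z z = 0"
    using A B by (auto simp: orth_pattern_def)
  have A0: "A i j = 0 \<longleftrightarrow> i = j \<and> i \<in> insert z Z1" if "i \<in> insert z I" "j \<in> insert z I" for i j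
    using A that unfolding orth_pattern_def by blast
  have B0: "B i j = 0 \<longleftrightarrow> i = j \<and> i \<in> insert z Z2" if "i \<in> insert z J" "j \<in> insert z J" for i j
    using B that unfolding orth_pattern_def by blast
  have split: "(\<Sum>t\<in>K. C i t * C j t) = (\<Sum>t\<in>I. C i t * C j t) + (\<Sum>t\<in>J. C i t * C j t)" for i j
    using disj fin sum.union_disjoint by metis
  have J: "i \<in> J \<Longrightarrow> i \<notin> I" for i using disj by auto
  have "orth_pattern K Z C"
    unfolding orth_pattern_def
  proof (intro ballI conjI)
    fix i j assume ij: "i \<in> K" "j \<in> K"
    show "C i j = 0 \<longleftrightarrow> i = j \<and> i \<in> Z"
    proof -
      have iz: "x \<in> Z \<longleftrightarrow> x \<in> Z1" if "x \<in> I" for x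
        using that Z1 F unfolding I_def by auto
      have jz: "x \<in> Z \<longleftrightarrow> x \<in> Z2" if "x \<in> J" for x
        using that Z1 F unfolding I_def J_def Z2_def by auto
      show ?thesis
        using ij disj zI A0 B0 iz jz J by (auto simp: C_def)
    qed
    have s1: "(\<Sum>t\<in>I. C i t * C j t) = 
       (if i \<in> I then if j \<in> I then \<Sum>t\<in>I. A i t * A j t else B j z * (\<Sum>t\<in>I. A i t * A z t)
        else if j \<in> I then B i z * (\<Sum>t\<in>I. A z t * A j t) else B i z * B j z * (\<Sum>t\<in>I. A z t * A z t))"
      by (auto simp: C_def sum_distrib_left mult_ac intro!: sum.cong)
    have s2: "(\<Sum>t\<in>J. C i t * C j t) = 
       (if i \<in> I then if j \<in> I then A i z * A j z * (\<Sum>t\<in>J. B z t * B z t) else A i z * (\<Sum>t\<in>J. B z t * B j t)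
        else if j \<in> I then A j z * (\<Sum>t\<in>J. B i t * B z t) else (\<Sum>t\<in>J. B i t * B j t))"
      using J by (auto simp: C_def sum_distrib_left mult_ac intro!: sum.cong)
    show "(\<Sum>t\<in>K. C i t * C j t) = (if i = j then 1 else 0)"
      using ij disj zI unfolding split s1 s2 
      by (auto simp: Aorth Borth zz)
  qed
  then show "\<exists>A. orth_pattern K Z A" by blast
qed

text \<open>With the ranges given as lists, simplification unrolls all conditions on an explicit
  matrix into finitely many arithmetic facts.\<close>

lemma pattern_existsI_list:
  fixes R :: "real list list"
  assumes "k \<le> n"
    and "\<forall>i\<in>set [0..<n]. \<forall>j\<in>set [0..<n].
      ((\<Sum>t\<leftarrow>[0..<n]. R ! i ! t * R ! j ! t) = 0 \<longleftrightarrow> i \<noteq> j) \<and> (R ! i ! j = 0 \<longleftrightarrow> i = j \<and> i < k)"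
  shows "pattern_exists n k"
  by (rule pattern_existsI[of k n "\<lambda>i j. R ! i ! j"])
    (use assms in \<open>auto simp: interv_sum_list_conv_sum_set_nat atLeast0LessThan\<close>)

section \<open>Explicit orthogonal matrices of small order\<close>

lemma pattern_exists_2_2: "pattern_exists 2 2"
  by (rule pattern_existsI_list[where R = "[[0, 1], [1, 0]]"]) (simp_all add: upt_rec)

lemma pattern_exists_3_1: "pattern_exists 3 1"
  by (rule pattern_existsI_list[where R = "[[0, 1, -1], [1, -1, -1], [2, 1, 1]]"])
    (simp_all add: upt_rec)

lemma pattern_exists_4:
  assumes "1 \<le> k" "k \<le> 4"
  shows "pattern_exists 4 k"
proof -
  have "pattern_exists 4 1"
    by (rule pattern_existsI_list[where R = "[[0, -1, 1, 1], [3, -1, -2, 1], [1, 2, 1, 1], [-3, 1, -3, 4]]"])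
      (simp_all add: upt_rec)
  moreover have "pattern_exists 4 2"
    by (rule pattern_existsI_list[where R = "[[0, 1, -1, -1], [1, 0, -1, 1], [1, -3, -1, -2], [3, 1, 2, -1]]"])
      (simp_all add: upt_rec)
  moreover have "pattern_exists 4 3"
    by (rule pattern_existsI_list[where R = "[[0, 1, -1, -1], [2, 0, -1, 1], [1, -2, 0, -2], [2, 2, 3, -1]]"])
      (simp_all add: upt_rec)
  moreover have "pattern_exists 4 4"
    by (rule pattern_existsI_list[where R = "[[0, 1, -1, -1], [1, 0, -1, 1], [1, -1, 0, -1], [1, 1, 1, 0]]"])
      (simp_all add: upt_rec)
  moreover have "k = 1 \<or> k = 2 \<or> k = 3 \<or> k = 4"
    using assms by linarith
  ultimately show ?thesis by blast
qed

lemma pattern_exists_5_4: "pattern_exists 5 4"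
  by (rule pattern_existsI_list[where R = "[[0, -1, -2, -1, 1], [-1, 0, 1, -1, 1], [-1, -1, 0, 2, 1],
        [2, -1, 1, 0, 1], [1, 4, -1, 1, 3]]"])
    (simp_all add: upt_rec)

lemma pattern_exists_5_5: "pattern_exists 5 5"
proof -
  \<comment> \<open>The circulant with first row \<open>(0, a, -2a, 1, 1)\<close> has orthogonal rows iff \<open>2a\<^sup>2 + 2a = 1\<close>.\<close>
  define a :: real where "a = (sqrt 3 - 1) / 2"
  have aa: "a * a = 1/2 - a"
    by (simp add: a_def field_simps)
  then have aa': "a * 2 + a * (a * 2) = 1" "a * (a * 4) = 2 - a * 4"
    by (simp_all add: mult.assoc[symmetric])
  \<comment> \<open>The squared row norm is 5 \<open>a * a\<close> + 2 = 9/2 - 5 \<open>a\<close>,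
    so it is nonzero exactly if \<open>a * 10\<close> differs from 9.\<close>
  have "sqrt 3 > 1" "sqrt 3 < 2"
    by (simp_all add: real_less_lsqrt)
  then have a: "a > 0" "a * 10 \<noteq> 9"
    by (auto simp: a_def)
  show ?thesis
    by (rule pattern_existsI_list[where R = "[[0, a, -2*a, 1, 1], [1, 0, a, -2*a, 1], [1, 1, 0, a, -2*a],
        [-2*a, 1, 1, 0, a], [a, -2*a, 1, 1, 0]]"])
      (use a in \<open>simp_all add: upt_rec algebra_simps aa aa'\<close>)
qed

text \<open>If \<open>k\<close> is at least \<open>n - 1\<close>, gluing with a
  \<open>(4, 4)\<close> matrix reduces to \<open>(n - 2, k - 2)\<close>; otherwise gluing with a
  \<open>(3, 1)\<close> matrix reduces to \<open>(n - 1, k + 1)\<close>. For \<open>n = 5\<close>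
  the first reduction would end in the excluded pairs \<open>(3, 2)\<close> and
  \<open>(3, 3)\<close>, hence the separate matrices.\<close>

lemma pattern_exists_ge_4:
  assumes "4 \<le> n" "1 \<le> k" "k \<le> n"
  shows "pattern_exists n k"
  using assms
proof (induction n arbitrary: k rule: less_induct)
  case (less n)
  consider "n = 4" | "n = 5" "k = 4" | "n = 5" "k = 5" | "n \<ge> 6" "k + 1 \<ge> n" | "n \<ge> 5" "k + 2 \<le> n"
    using less.prems by linarith
  then show ?case
  proof cases
    case 4
    have "pattern_exists (n - 2) (k - 2)"
      using less.prems 4 by (intro less.IH) auto
    moreover have "n - 2 = Suc (n - 3)" "k - 2 = Suc (k - 3)" "n = n - 3 + 3" "k = k - 3 + 3"
      using 4 by auto
    ultimately show ?thesis
      using pattern_exists_glue[of "n - 3" "k - 3" 3 3] pattern_exists_4[of 4] less.prems by auto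
  next
    case 5
    have "pattern_exists (n - 1) (k + 1)"
      using less.prems 5 by (intro less.IH) auto
    moreover have "n - 1 = Suc (n - 2)" "n = n - 2 + 2"
      using 5 by auto
    ultimately show ?thesis
      using pattern_exists_glue[of "n - 2" k 2 0] pattern_exists_3_1 5 by auto
  qed (use pattern_exists_4 less.prems pattern_exists_5_4 pattern_exists_5_5 in auto)
qed

subsection \<open>Symmetric matrices with few eigenvalues\<close>

definition mat_trace :: "'a::comm_ring_1 mat \<Rightarrow> 'a" where
  "mat_trace A = (\<Sum>i<dim_row A. A $$ (i, i))"

lemma mat_trace_mult:
  assumes "A \<in> carrier_mat n n" "B \<in> carrier_mat n n"
  shows "mat_trace (A * B) = (\<Sum>i<n. \<Sum>t<n. A $$ (i, t) * B $$ (t, i))"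
  using assms by (simp add: mat_trace_def scalar_prod_def atLeast0LessThan)

lemma mat_trace_comm:
  assumes "A \<in> carrier_mat n n" "B \<in> carrier_mat n n"
  shows "mat_trace (A * B) = mat_trace (B * A)"
  unfolding mat_trace_mult[OF assms] mat_trace_mult[OF assms(2,1)]
  by (subst sum.swap) (simp add: mult.commute)

lemma mat_trace_similar:
  assumes "similar_mat_wit A B P Q"
  shows "mat_trace A = mat_trace B"
proof -
  define n where "n = dim_row A"
  note w = similar_mat_witD[OF n_def assms]
  have "mat_trace A = mat_trace (P * (B * Q))"
    using w by (simp add: assoc_mult_mat[of P n n B n Q n])
  also have "\<dots> = mat_trace (B * Q * P)"
    using w by (intro mat_trace_comm) auto
  also have "B * Q * P = B"
    using w by (simp add: assoc_mult_mat[of B n n Q n P n])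
  finally show ?thesis .
qed

text \<open>Links the real spectrum to the complex eigenvalues seen by the Schur form. Pairing
  \<open>A v\<close> with the conjugate of \<open>v\<close> and moving \<open>A\<close> across shows
  that \<open>e\<close> equals its conjugate.\<close>

lemma eigenvalue_sym_real:
  fixes A :: "real mat"
  assumes A: "A \<in> carrier_mat n n" "transpose_mat A = A"
    and e: "eigenvalue (map_mat complex_of_real A) e"
  shows "\<exists>c\<in>spectrum A. e = complex_of_real c"
proof -
  let ?A = "map_mat complex_of_real A"
  have cA: "?A \<in> carrier_mat n n" using A by simp
  obtain v where v: "v \<in> carrier_vec n" "v \<noteq> 0\<^sub>v n" and ev: "?A *\<^sub>v v = e \<cdot>\<^sub>v v"
    using e A unfolding eigenvalue_def eigenvector_def by auto
  let ?w = "conjugate v"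
  have w: "?w \<in> carrier_vec n" using v by simp
  have t: "transpose_mat ?A = ?A"
    using A by (metis map_mat_transpose)
  have ew: "?A *\<^sub>v ?w = conjugate e \<cdot>\<^sub>v ?w"
  proof -
    have "conjugate (?A *\<^sub>v v) = ?A *\<^sub>v ?w"
      using A(1) v(1) by (intro eq_vecI) (auto simp: scalar_prod_def)
    then show ?thesis
      by (simp add: ev conjugate_smult_vec)
  qed
  have "(?A *\<^sub>v v) \<bullet> ?w = v \<bullet> (?A *\<^sub>v ?w)"
    using transpose_vec_mult_scalar[OF cA v(1) w] unfolding t
    using cA v w by (metis comm_scalar_prod mult_mat_vec_carrier)
  then have "e * (v \<bullet>c v) = conjugate e * (v \<bullet>c v)"
    unfolding ev ew using v w by simp
  moreover have "v \<bullet>c v \<noteq> 0"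
    using v by simp
  ultimately have "e = cnj e" by simp
  then have e': "e = complex_of_real (Re e)"
    by (metis of_real_Re Reals_cnj_iff)
  have "poly (char_poly ?A) e = 0"
    using eigenvalue_root_char_poly[OF cA] assms(3) by simp
  then have "poly (map_poly complex_of_real (char_poly A)) (complex_of_real (Re e)) = 0"
    by (simp add: of_real_hom.char_poly_hom[OF A(1)] e'[symmetric])
  then have "poly (char_poly A) (Re e) = 0"
    by simp
  then show ?thesis
    using e' by (intro bexI[of _ "Re e"]) (auto simp: spectrum_root_char_poly[OF A(1)])
qed

text \<open>A complex Schur form of \<open>A\<close> is triangular with constant diagonal
  \<open>c\<close>, so \<open>A\<close> and \<open>A * A\<close> have traces \<open>n * c\<close>
  and \<open>n * c\<^sup>2\<close>. These determine the Frobenius distance from \<open>A\<close> to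
  the scalar matrix of \<open>c\<close>.\<close>

lemma sym_single_eigenvalue_diagonal:
  fixes A :: "real mat"
  assumes A: "A \<in> carrier_mat n n" "transpose_mat A = A"
    and spec: "spectrum A \<subseteq> {c}"
    and ij: "i < n" "j < n" "i \<noteq> j"
  shows "A $$ (i, j) = 0"
proof -
  let ?A = "map_mat complex_of_real A"
  have cA: "?A \<in> carrier_mat n n" using A by simp
  obtain es where es: "char_poly ?A = (\<Prod>a\<leftarrow>es. [:- a, 1:])" "length es = n"
    using char_poly_factorized[OF cA] by blast
  obtain B P Q where "schur_decomposition ?A es = (B, P, Q)"
    by (cases "schur_decomposition ?A es")
  then have w: "similar_mat_wit ?A B P Q" and up: "upper_triangular B" and diag: "diag_mat B = es"
    using schur_decomposition[OF cA es(1)] by auto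
  have B: "B \<in> carrier_mat n n"
    using similar_mat_witD2[OF cA w] by auto
  have "a = complex_of_real c" if "a \<in> set es" for a
  proof -
    have "eigenvalue ?A a"
      unfolding eigenvalue_root_char_poly[OF cA] es using that by (rule linear_poly_root)
    then show ?thesis using eigenvalue_sym_real[OF A] spec by blast
  qed
  then have Bd: "B $$ (i, i) = complex_of_real c" if "i < n" for i
    using that B diag by (force simp: diag_mat_def)
  have "complex_of_real (mat_trace A) = mat_trace ?A"
    using A by (simp add: mat_trace_def)
  also have "\<dots> = mat_trace B"
    using w by (rule mat_trace_similar)
  also have "\<dots> = complex_of_real (n * c)"
    using B Bd by (simp add: mat_trace_def)
  finally have tr1: "mat_trace A = n * c"
    using of_real_eq_iff by blast
  have w2: "similar_mat_wit (?A * ?A) (B * B) P Q"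
    using similar_mat_wit_pow[OF w, of 2] cA B by (simp add: numeral_2_eq_2)
  have "mat_trace (?A * ?A) = mat_trace (B * B)"
    using w2 by (rule mat_trace_similar)
  also have "\<dots> = (\<Sum>i<n. \<Sum>t<n. if t = i then complex_of_real (c\<^sup>2) else 0)"
    unfolding mat_trace_mult[OF B B]
  proof (intro sum.cong refl)
    \<comment> \<open>Off the diagonal one of the two factors lies below the diagonal of the
      triangular \<open>B\<close>.\<close>
    fix i t assume "i \<in> {..<n}" "t \<in> {..<n}"
    then show "B $$ (i, t) * B $$ (t, i) = (if t = i then complex_of_real (c\<^sup>2) else 0)"
      using Bd B upper_triangularD[OF up, of i t] upper_triangularD[OF up, of t i]
      by (cases t i rule: linorder_cases) (auto simp: power2_eq_square)
  qed
  also have "\<dots> = complex_of_real (n * c\<^sup>2)"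
    by simp
  finally have "complex_of_real (mat_trace (A * A)) = complex_of_real (n * c\<^sup>2)"
    unfolding mat_trace_mult[OF cA cA] mat_trace_mult[OF A(1) A(1)] using A by simp
  then have "mat_trace (A * A) = n * c\<^sup>2"
    using of_real_eq_iff by blast
  moreover have sym: "A $$ (s, t) = A $$ (t, s)" if "s < n" "t < n" for s t
    using A that by (metis carrier_matD index_transpose_mat(1))
  ultimately have tr2: "(\<Sum>s<n. \<Sum>t<n. (A $$ (s, t))\<^sup>2) = n * c\<^sup>2"
    unfolding mat_trace_mult[OF A(1) A(1)] by (simp add: power2_eq_square)
  \<comment> \<open>The squared Frobenius norm of \<open>A - c I\<close> is \<open>tr (A\<^sup>2) - 2 c tr A + n c\<^sup>2\<close>, which vanishes.\<close>
  have "(\<Sum>s<n. \<Sum>t<n. (A $$ (s, t) - (if s = t then c else 0))\<^sup>2)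
      = (\<Sum>s<n. \<Sum>t<n. (A $$ (s, t))\<^sup>2 + (if s = t then c\<^sup>2 - 2 * c * A $$ (s, s) else 0))"
    by (intro sum.cong refl) (simp add: power2_diff)
  also have "\<dots> = n * c\<^sup>2 + (\<Sum>s<n. c\<^sup>2 - 2 * c * A $$ (s, s))"
    by (simp add: sum.distrib tr2)
  also have "\<dots> = 2 * n * c\<^sup>2 - 2 * c * mat_trace A"
    using A by (simp add: sum_subtractf mat_trace_def sum_distrib_left)
  also have "\<dots> = 0"
    by (simp add: tr1 power2_eq_square)
  finally have "(A $$ (i, j) - (if i = j then c else 0))\<^sup>2 = 0"
    using ij by (simp add: sum_nonneg_eq_0_iff sum_nonneg)
  then show ?thesis
    using ij by simp
qed

section \<open>Lower and upper bounds for \<open>q\<close>\<close>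

lemma q_ge_2:
  assumes "E \<noteq> {}" "simple_graph N E"
  shows "q N E \<ge> 2"
proof (rule ccontr)
  assume "\<not> q N E \<ge> 2"
  then obtain A where A: "A \<in> sym_mats N E" and "card (spectrum A) \<le> 1"
    using q_attained[of N E] by force
  then have car: "A \<in> carrier_mat N N" "transpose_mat A = A"
    by (auto simp: sym_mats_def)
  \<comment> \<open>Inclusion instead of equality also covers an empty spectrum.\<close>
  obtain c where c: "spectrum A \<subseteq> {c}"
    using card_finite_spectrum(1)[OF car(1)] \<open>card (spectrum A) \<le> 1\<close>
    by (metis card_le_Suc0_iff_eq One_nat_def insertCI subsetI ex_in_conv)
  obtain e where "e \<in> E" using assms by blast
  then obtain i j where ij: "e = {i, j}" "i \<noteq> j" "i < N" "j < N"
    using assms(2) unfolding simple_graph_def by (metis card_2_iff insert_subset lessThan_iff)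
  then have "A $$ (i, j) \<noteq> 0"
    using A \<open>e \<in> E\<close> by (auto simp: sym_mats_def)
  then show False
    using sym_single_eigenvalue_diagonal[OF car c ij(3,4,2)] by blast
qed

lemma eigenvalue_involution:
  fixes A :: "'a::field mat"
  assumes A: "A \<in> carrier_mat n n" "A * A = 1\<^sub>m n" and "eigenvalue A e"
  shows "e = 1 \<or> e = -1"
proof -
  obtain v where v: "v \<in> carrier_vec n" "v \<noteq> 0\<^sub>v n" and ev: "A *\<^sub>v v = e \<cdot>\<^sub>v v"
    using assms unfolding eigenvalue_def eigenvector_def by auto
  have "v = A *\<^sub>v (A *\<^sub>v v)"
    using A v by (metis assoc_mult_mat_vec one_mult_mat_vec)
  also have "\<dots> = (e * e) \<cdot>\<^sub>v v"
    using A v by (simp add: ev mult_mat_vec smult_smult_assoc)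
  finally have vv: "v = (e * e) \<cdot>\<^sub>v v" .
  obtain i where i: "i < n" "v $ i \<noteq> 0"
    using v by (metis carrier_vecD eq_vecI index_zero_vec)
  have "v $ i = e * e * v $ i"
    using arg_cong[OF vv, of "\<lambda>u. u $ i"] i v by simp
  then show ?thesis
    using i by (simp add: square_eq_1_iff)
qed

lemma q_le_2_if_involution:
  assumes "A \<in> sym_mats N E" "A * A = 1\<^sub>m N"
  shows "q N E \<le> 2"
proof -
  have "q N E \<le> card (spectrum A)"
    unfolding q_def using assms(1) by (intro Least_le) blast
  also have "\<dots> \<le> card {1, -1 :: real}"
    using eigenvalue_involution[of A N] assms
    by (intro card_mono) (auto simp: spectrum_def sym_mats_def)
  finally show ?thesis by simp
qed

text \<open>The square of \<open>A\<close> has diagonal blocks \<open>U * transpose_mat U\<close>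
  and \<open>transpose_mat U * U\<close>. The first is the identity by hypothesis, the second
  because a one-sided inverse of a square matrix is two-sided.\<close>

lemma involution_of_orthogonal:
  fixes Q :: "nat \<Rightarrow> nat \<Rightarrow> real"
  assumes "\<And>i j. i < n \<Longrightarrow> j < n \<Longrightarrow> (\<Sum>t<n. Q i t * Q j t) = (if i = j then 1 else 0)"
  defines "A \<equiv> mat (n + n) (n + n) (\<lambda>(i, j). if i < n \<and> n \<le> j then Q i (j - n)
    else if n \<le> i \<and> j < n then Q j (i - n) else 0)"
  shows "A * A = 1\<^sub>m (n + n)"
proof -
  define U where "U = mat n n (\<lambda>(i, j). Q i j)"
  have U: "U \<in> carrier_mat n n" "transpose_mat U \<in> carrier_mat n n"
    by (auto simp: U_def)
  have "U * transpose_mat U = 1\<^sub>m n"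
    using assms(1) by (intro eq_matI) (auto simp: U_def scalar_prod_def atLeast0LessThan)
  then have UT: "U * transpose_mat U = 1\<^sub>m n" "transpose_mat U * U = 1\<^sub>m n"
    using mat_mult_left_right_inverse[OF U] by auto
  have "A = four_block_mat (0\<^sub>m n n) U (transpose_mat U) (0\<^sub>m n n)"
    by (intro eq_matI) (auto simp: A_def U_def)
  then have "A * A = four_block_mat (1\<^sub>m n) (0\<^sub>m n n) (0\<^sub>m n n) (1\<^sub>m n)"
    using U UT
    by (simp add: mult_four_block_mat[OF zero_carrier_mat U zero_carrier_mat zero_carrier_mat U zero_carrier_mat])
  then show ?thesis by simp
qed

subsection \<open>Complete bipartite graphs minus a matching\<close>

lemma complete_bipartite_edge_iff:
  assumes "j < n"
  shows "{i, m + j} \<in> complete_bipartite m n \<longleftrightarrow> i < m"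
  using assms by (fastforce simp: complete_bipartite_def doubleton_eq_iff)

lemma complete_bipartite_edge_cases:
  assumes "{i, j} \<in> complete_bipartite m n"
  shows "i < m \<and> m \<le> j \<and> j < m + n \<or> j < m \<and> m \<le> i \<and> i < m + n"
  using assms by (auto simp: complete_bipartite_def doubleton_eq_iff)

lemma matching_eqI:
  assumes "matching E M" "e \<in> M" "e' \<in> M" "x \<in> e" "x \<in> e'"
  shows "e = e'"
  using assms unfolding matching_def pairwise_def disjnt_def by blast

text \<open>A matching is a partial injection \<open>g\<close> from left to right, defined on the
  set \<open>D\<close> of matched left vertices, and extends to a permutation \<open>f\<close>.
  Relabelling the right part along \<open>f\<close> puts the matching on the diagonal.\<close>

lemma matching_bipartite_bij:
  assumes M: "matching (complete_bipartite n n) M"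
  shows "\<exists>D f. D \<subseteq> {..<n} \<and> card D = card M \<and> bij_betw f {..<n} {..<n} \<and>
    (\<forall>i<n. \<forall>j<n. {i, n + j} \<in> M \<longleftrightarrow> i \<in> D \<and> j = f i)"
proof -
  define D where "D = {i. i < n \<and> (\<exists>j<n. {i, n + j} \<in> M)}"
  have "\<forall>i\<in>D. \<exists>j. j < n \<and> {i, n + j} \<in> M"
    by (auto simp: D_def)
  then obtain g where g: "\<And>i. i \<in> D \<Longrightarrow> g i < n" "\<And>i. i \<in> D \<Longrightarrow> {i, n + g i} \<in> M"
    by metis
  have D: "D \<subseteq> {..<n}"
    by (auto simp: D_def)
  have iff: "{i, n + j} \<in> M \<longleftrightarrow> i \<in> D \<and> j = g i" if "i < n" "j < n" for i j
  proof
    assume e: "{i, n + j} \<in> M"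
    then have "i \<in> D"
      using that by (auto simp: D_def)
    moreover have "{i, n + j} = {i, n + g i}"
      using matching_eqI[OF M e g(2)[OF \<open>i \<in> D\<close>], of i] by simp
    ultimately show "i \<in> D \<and> j = g i"
      using that by (auto simp: doubleton_eq_iff)
  qed (use g in auto)
  have inj: "inj_on g D"
  proof (rule inj_onI)
    fix i j assume ij: "i \<in> D" "j \<in> D" "g i = g j"
    have "{i, n + g i} = {j, n + g j}"
      using matching_eqI[OF M g(2)[OF ij(1)] g(2)[OF ij(2)], of "n + g i"] ij(3) by simp
    then show "i = j"
      using ij D by (auto simp: doubleton_eq_iff)
  qed
  have "bij_betw (\<lambda>i. {i, n + g i}) D M"
  proof (rule bij_betwI')
    fix i j assume "i \<in> D" "j \<in> D"
    then show "({i, n + g i} = {j, n + g j}) = (i = j)"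
      using D by (auto simp: doubleton_eq_iff)
  next
    fix e assume e: "e \<in> M"
    then have "e \<in> complete_bipartite n n"
      using M by (auto simp: matching_def)
    then obtain i j where "e = {i, j}" "i < n" "n \<le> j" "j < n + n"
      by (auto simp: complete_bipartite_def)
    then have "e = {i, n + (j - n)}" "j - n < n"
      by auto
    then show "\<exists>i\<in>D. e = {i, n + g i}"
      using iff[OF \<open>i < n\<close>, of "j - n"] e by auto
  qed (use g in auto)
  then have "card D = card M"
    by (rule bij_betw_same_card)
  moreover have "\<exists>f. bij_betw f {..<n} {..<n} \<and> (\<forall>i\<in>D. f i = g i) \<and>
      (\<forall>i\<in>{..<n}. f i \<in> g ` D \<longleftrightarrow> i \<in> D)"
    by (rule ex_bij_betw_extend[OF _ _ _ D _ inj_on_imp_bij_betw[OF inj]]) (use g in auto)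
  then obtain f where "bij_betw f {..<n} {..<n}" "\<forall>i\<in>D. f i = g i"
    by blast
  ultimately show ?thesis
    using D iff by (intro exI[of _ D] exI[of _ f]) auto
qed

lemma sym_mats_bipartiteI:
  fixes Q :: "nat \<Rightarrow> nat \<Rightarrow> real"
  assumes "M \<subseteq> complete_bipartite n n"
    and "\<And>i j. i < n \<Longrightarrow> j < n \<Longrightarrow> Q i j = 0 \<longleftrightarrow> {i, n + j} \<in> M"
  shows "mat (n + n) (n + n) (\<lambda>(i, j). if i < n \<and> n \<le> j then Q i (j - n)
    else if n \<le> i \<and> j < n then Q j (i - n) else 0) \<in> sym_mats (n + n) (complete_bipartite n n - M)"
    (is "?A \<in> _")
proof -
  have "?A $$ (i, j) \<noteq> 0 \<longleftrightarrow> {i, j} \<in> complete_bipartite n n - M"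
    if ij: "i < n + n" "j < n + n" for i j
  proof -
    consider "i < n" "n \<le> j" | "n \<le> i" "j < n" | "i < n \<longleftrightarrow> j < n"
      by linarith
    then show ?thesis
    proof cases
      case 1
      then show ?thesis
        using ij assms(2)[of i "j - n"] complete_bipartite_edge_iff[of "j - n" n i n] by simp
    next
      case 2
      then show ?thesis
        using ij assms(2)[of j "i - n"] complete_bipartite_edge_iff[of "i - n" n j n]
        by (simp add: insert_commute)
    next
      case 3
      then have "{i, j} \<notin> complete_bipartite n n"
        using complete_bipartite_edge_cases[of i j n n] by auto
      then show ?thesis
        using 3 ij by auto
    qed
  qed
  then show ?thesis
    by (auto simp: sym_mats_def)
qed

theorem corollary5p9:
  fixes n k :: nat and M :: "nat set set"
  assumes "n \<ge> 1" and "1 \<le> k" and "k \<le> n"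
    and "matching (complete_bipartite n n) M" and "card M = k"
    and "(n, k) \<notin> {(1, 1), (2, 1), (3, 2), (3, 3)}"
  shows "q (n + n) (complete_bipartite n n - M) = 2"
proof (rule antisym)
  \<comment> \<open>The admissible pairs with \<open>n\<close> below 4 are \<open>(2, 2)\<close> and
    \<open>(3, 1)\<close>.\<close>
  consider "n \<ge> 4" | "n = 2" "k = 2" | "n = 3" "k = 1"
    using assms(1-3,6) by force
  then have "pattern_exists n k"
    using pattern_exists_ge_4 pattern_exists_2_2 pattern_exists_3_1 assms(2,3) by cases auto
  obtain D f where D: "D \<subseteq> {..<n}" "card D = k" and f: "bij_betw f {..<n} {..<n}"
    and M: "\<forall>i<n. \<forall>j<n. {i, n + j} \<in> M \<longleftrightarrow> i \<in> D \<and> j = f i"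
    using matching_bipartite_bij[OF assms(4)] unfolding assms(5) by blast
  obtain A where A: "orth_pattern {..<n} D A"
    using \<open>pattern_exists n k\<close>[unfolded pattern_exists_def, rule_format, of "{..<n}" D] D by auto
  \<comment> \<open>Permuting the columns moves the zero of row \<open>i\<close> from column
    \<open>i\<close> to column \<open>f i\<close> and preserves row products.\<close>
  define h where "h = inv_into {..<n} f"
  have h: "bij_betw h {..<n} {..<n}"
    unfolding h_def by (rule bij_betw_inv_into[OF f])
  have hf: "h (f i) = i" if "i < n" for i
    using that bij_betw_inv_into_left[OF f] by (simp add: h_def)
  have fh: "f (h j) = j" "h j < n" if "j < n" for j
    using that bij_betw_inv_into_right[OF f] bij_betw_apply[OF h] by (auto simp: h_def)
  let ?Q = "\<lambda>i j. A i (h j)"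
  have "(\<Sum>t<n. ?Q i t * ?Q j t) = (if i = j then 1 else 0)" if "i < n" "j < n" for i j
    using A that sum.reindex_bij_betw[OF h, of "\<lambda>t. A i t * A j t"] by (simp add: orth_pattern_def)
  note inv = involution_of_orthogonal[of n ?Q, OF this]
  have zero: "?Q i j = 0 \<longleftrightarrow> {i, n + j} \<in> M" if "i < n" "j < n" for i j
  proof -
    have "?Q i j = 0 \<longleftrightarrow> i = h j \<and> i \<in> D"
      using A that fh(2) unfolding orth_pattern_def by blast
    then show ?thesis
      using M fh(1) hf that by auto
  qed
  have "M \<subseteq> complete_bipartite n n"
    using assms(4) by (simp add: matching_def)
  from q_le_2_if_involution[OF sym_mats_bipartiteI[OF this zero] inv]
  show "q (n + n) (complete_bipartite n n - M) \<le> 2"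
    by simp
next
  have "n \<ge> 2"
    using assms by force
  \<comment> \<open>Vertex 0 has two neighbours in the complete bipartite graph, but
    \<open>M\<close> covers it at most once, so an edge survives.\<close>
  have "{0, n + 0} \<notin> M \<or> {0, n + 1} \<notin> M"
    using matching_eqI[OF assms(4), of "{0, n + 0}" "{0, n + 1}" 0] by (auto simp: doubleton_eq_iff)
  moreover have "{0, n + 0} \<in> complete_bipartite n n" "{0, n + 1} \<in> complete_bipartite n n"
    using \<open>n \<ge> 2\<close> complete_bipartite_edge_iff[of 0 n 0 n] complete_bipartite_edge_iff[of 1 n 0 n]
    by simp_all
  ultimately have "complete_bipartite n n - M \<noteq> {}"
    by blast
  then show "2 \<le> q (n + n) (complete_bipartite n n - M)"
    using simple_graph_complete_bipartite_delete by (rule q_ge_2)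
qed

end
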